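(* Let $k$ be an algebraically closed field, let $R=k[x,y]$, and let $c_1,c_2,\ldots$ be pairwise distinct elements of $k$. Set $X=\{(c_j,0):j\ge1\}\subseteq k^2$ and define $\nu:X\to\mathbb{N}_{>0}$ by $\nu(c_j,0)=j$. Then $$y\in\mathcal{I}(X)\qquad\text{and}\qquad y\notin\sqrt{\Phi^{*}_{X,\nu}(0)}.$$ Consequently, the identity $\sqrt{\Phi^{*}_{X,\nu}(I)}=\mathcal{I}\bigl(X\cap V_{\mathrm{aff}}(I)\bigr)$, which is valid for all ideals $I$ of a polynomial ring over a field whenever $\nu$ is bounded, does not hold in general if the boundedness hypothesis on $\nu$ is omitted.
   Context: For a polynomial ring $R=k[x_1,\ldots,x_n]$ over a field and $a=(a_1,\ldots,a_n)\in k^n$, $\mathfrak{m}_a=(x_1-a_1,\ldots,x_n-a_n)$. For an ideal $I$ of $R$, $V_{\mathrm{aff}}(I)=\{a\in k^n: f(a)=0\text{ for every }f\in I\}$. For $Y\subseteq k^n$, $\mathcal{I}(Y)=\{f\in R: f(a)=0\text{ for every }a\in Y\}$. For $X\subseteq k^n$, $\nu:X\to\mathbb{N}_{>0}$ and an ideal $I$ of $R$, $\Phi^{*}_{X,\nu}(I)=\bigcap_{a\in X}\bigl(I+\mathfrak{m}_a^{\nu(a)}\bigr)$ (equal to $R$ if $X=\varnothing$). The function $\nu$ is bounded if there is a positive integer $N$ with $\nu(a)\le N$ for every $a\in X$. *)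

theory Defs
  imports
    "HOL-Library.Poly_Mapping"
    "HOL-Library.Set_Algebras"
    "HOL-Computational_Algebra.Polynomial"
    "HOL-Analysis.Cartesian_Space"
begin

text \<open>
  The polynomial ring in finitely many variables, indexed by a finite type: a polynomial is the
  finitely supported map from exponent vectors to coefficients. The ring structure (convolution
  product) is the one of \<^theory>\<open>HOL-Library.Poly_Mapping\<close>.
\<close>

type_synonym ('n, 'k) mpoly = "('n \<Rightarrow>\<^sub>0 nat) \<Rightarrow>\<^sub>0 'k"

definition Const :: "'k::zero \<Rightarrow> ('n, 'k) mpoly"
  where "Const c = Poly_Mapping.single 0 c"

definition Var :: "'n \<Rightarrow> ('n, 'k::zero_neq_one) mpoly"
  where "Var i = Poly_Mapping.single (Poly_Mapping.single i 1) 1"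

definition eval :: "('n::finite, 'k::comm_semiring_1) mpoly \<Rightarrow> 'k ^ 'n \<Rightarrow> 'k"
  where "eval f a =
    (\<Sum>m\<in>Poly_Mapping.keys f.
       Poly_Mapping.lookup f m * (\<Prod>i\<in>UNIV. a $ i ^ Poly_Mapping.lookup m i))"

text \<open>Ideals are the submodules of the ring regarded as a module over itself. The locale is not
  interpreted, since its simp rules would reassociate products.\<close>

lemma module_times: "module ((*) :: 'a::comm_ring_1 \<Rightarrow> 'a \<Rightarrow> 'a)"
  by standard (simp_all add: algebra_simps)

definition is_ideal :: "'a::comm_ring_1 set \<Rightarrow> bool"
  where "is_ideal = module.subspace (*)"

definition ideal_gen :: "'a::comm_ring_1 set \<Rightarrow> 'a set"
  where "ideal_gen = module.span (*)"

lemma is_ideal_iff: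
  "is_ideal I \<longleftrightarrow> 0 \<in> I \<and> (\<forall>f\<in>I. \<forall>g\<in>I. f + g \<in> I) \<and> (\<forall>r. \<forall>f\<in>I. r * f \<in> I)"
  by (auto simp: is_ideal_def module.subspace_def[OF module_times])

lemma ideal_gen_eq_Inter: "ideal_gen S = \<Inter>{I. is_ideal I \<and> S \<subseteq> I}"
  by (simp add: ideal_gen_def is_ideal_def module.span_def[OF module_times] hull_def)

primrec ideal_power :: "'a::comm_ring_1 set \<Rightarrow> nat \<Rightarrow> 'a set"
  where
    "ideal_power I 0 = UNIV"
  | "ideal_power I (Suc n) = ideal_gen {f * g |f g. f \<in> I \<and> g \<in> ideal_power I n}"

definition radical :: "'a::comm_ring_1 set \<Rightarrow> 'a set"
  where "radical I = {f. \<exists>n>0. f ^ n \<in> I}"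

definition max_ideal_at :: "'k ^ 'n \<Rightarrow> ('n::finite, 'k::field) mpoly set"
  where "max_ideal_at a = ideal_gen (range (\<lambda>i. Var i - Const (a $ i)))"

definition V_aff :: "('n::finite, 'k::field) mpoly set \<Rightarrow> ('k ^ 'n) set"
  where "V_aff I = {a. \<forall>f\<in>I. eval f a = 0}"

definition vanishing_ideal :: "('k ^ 'n) set \<Rightarrow> ('n::finite, 'k::field) mpoly set"
  where "vanishing_ideal Y = {f. \<forall>a\<in>Y. eval f a = 0}"

text \<open>The sum of ideals is the elementwise sum of sets. An intersection over the empty set is
  the whole ring, and only the values of \<open>\<nu>\<close> on \<open>X\<close> matter.\<close>

definition Phi_star ::
    "('k ^ 'n) set \<Rightarrow> ('k ^ 'n \<Rightarrow> nat) \<Rightarrow> ('n::finite, 'k::field) mpoly set \<Rightarrow> ('n, 'k) mpoly set"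
  where "Phi_star X \<nu> I = (\<Inter>a\<in>X. I + ideal_power (max_ideal_at a) (\<nu> a))"

definition bounded_on :: "'p set \<Rightarrow> ('p \<Rightarrow> nat) \<Rightarrow> bool"
  where "bounded_on X \<nu> \<longleftrightarrow> (\<exists>N>0. \<forall>a\<in>X. \<nu> a \<le> N)"

end

theory Submission
  imports Defs
begin

text \<open>
  The identity for bounded \<open>\<nu>\<close> is local at each point \<open>a \<in> X\<close>. If \<open>a \<notin> V_aff I\<close>, then
  \<open>I\<close> and the maximal ideal \<open>\<mm>\<^sub>a\<close> are comaximal, hence so are \<open>I\<close> and every power of \<open>\<mm>\<^sub>a\<close>, and
  \<open>a\<close> imposes no condition (\<open>sum_ideal_power_eq_UNIV\<close>). If \<open>a \<in> V_aff I\<close>, then \<open>I\<close> lies in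
  \<open>\<mm>\<^sub>a\<close>; a polynomial \<open>f\<close> that vanishes at \<open>a\<close> lies in \<open>\<mm>\<^sub>a\<close>, so \<open>f\<^sup>N\<close> lies in
  \<open>\<mm>\<^sub>a\<^bsup>\<nu>(a)\<^esup>\<close> once \<open>N \<ge> \<nu>(a)\<close>. Boundedness serves to choose one exponent \<open>N\<close> for all points.

  Without a bound no common exponent need exist. Membership in \<open>\<mm>\<^sub>a\<^sup>n\<close> is detected on lines: if
  \<open>f \<in> \<mm>\<^sub>a\<^sup>n\<close>, then \<open>f(a + t v)\<close> is divisible by \<open>t\<^sup>n\<close> for every direction \<open>v\<close>
  (\<open>power_dvd_on_line\<close>). On the vertical line through \<open>(c, 0)\<close> the polynomial \<open>y\<^sup>n\<close> becomes \<open>t\<^sup>n\<close>,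
  so it is not in \<open>\<mm>\<^bsub>(c,0)\<^esub>\<^bsup>n+1\<^esup>\<close>. As \<open>X\<close> has a point of weight \<open>n + 1\<close> for each \<open>n\<close>, no power
  of \<open>y\<close> lies in \<open>\<Phi>*\<close> of the zero ideal, although \<open>y\<close> vanishes on \<open>X\<close>.
\<close>

section \<open>Generators of the polynomial ring and substitution\<close>

lemma mpoly_eq_sum_single:
  "f = (\<Sum>m\<in>Poly_Mapping.keys f. Poly_Mapping.single m (Poly_Mapping.lookup f m))"
  by (rule poly_mapping_eqI)
    (simp add: lookup_sum lookup_single when_def sum.delta' in_keys_iff)

lemma mpoly_single_induct:
  fixes f :: "('n, 'k::comm_monoid_add) mpoly"
  assumes "\<And>m c. P (Poly_Mapping.single m c)" and "\<And>f g. P f \<Longrightarrow> P g \<Longrightarrow> P (f + g)"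
  shows "P f"
proof -
  have "P (\<Sum>m\<in>A. Poly_Mapping.single m (Poly_Mapping.lookup f m))" if "finite A" for A
    using that
  proof (induction A rule: finite_induct)
    case empty
    show ?case using assms(1)[of 0 0] by simp
  qed (use assms in auto)
  then show ?thesis using mpoly_eq_sum_single[of f] by (metis finite_keys)
qed

lemma Const_mult: "Const (a * b) = Const a * (Const b :: ('n, 'k::comm_semiring_1) mpoly)"
  by (simp add: Const_def mult_single)

lemma Const_add: "Const (a + b) = Const a + (Const b :: ('n, 'k::comm_ring_1) mpoly)"
  by (simp add: Const_def single_add)

lemma Const_0: "Const 0 = (0 :: ('n, 'k::comm_ring_1) mpoly)"
  by (simp add: Const_def)

lemma Const_1: "Const 1 = (1 :: ('n, 'k::comm_ring_1) mpoly)"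
  by (simp add: Const_def)

lemma Var_power:
  "(Var i :: ('n, 'k::comm_semiring_1) mpoly) ^ e = Poly_Mapping.single (Poly_Mapping.single i e) 1"
  by (induction e) (simp_all add: Var_def mult_single flip: single_add)

lemma prod_single:
  "finite A \<Longrightarrow> (\<Prod>i\<in>A. Poly_Mapping.single (m i) (1::'k::comm_semiring_1))
     = (Poly_Mapping.single (\<Sum>i\<in>A. m i) 1 :: ('n, 'k) mpoly)"
  by (induction A rule: finite_induct) (simp_all add: mult_single)

lemma single_eq_Const_times_Vars:
  fixes c :: "'k::comm_semiring_1"
  shows "(Poly_Mapping.single m c :: ('n::finite, 'k) mpoly)
     = Const c * (\<Prod>i\<in>UNIV. Var i ^ Poly_Mapping.lookup m i)"
proof -
  have "(\<Sum>i\<in>UNIV. Poly_Mapping.single i (Poly_Mapping.lookup m i)) = m"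
    by (rule poly_mapping_eqI) (simp add: lookup_sum lookup_single when_def sum.delta')
  then show ?thesis
    by (simp add: Var_power prod_single Const_def mult_single)
qed

lemma mpoly_generators_induct:
  fixes f :: "('n::finite, 'k::comm_ring_1) mpoly"
  assumes Const: "\<And>c. P (Const c)" and Var: "\<And>i. P (Var i)"
    and add: "\<And>f g. P f \<Longrightarrow> P g \<Longrightarrow> P (f + g)" and mult: "\<And>f g. P f \<Longrightarrow> P g \<Longrightarrow> P (f * g)"
  shows "P f"
proof (induction f rule: mpoly_single_induct)
  case (1 m c)
  have one: "P 1" using Const[of 1] by (simp add: Const_1)
  have power: "P (Var i ^ e)" for i e
    by (induction e) (use one Var mult in auto)
  have "P (\<Prod>i\<in>A. Var i ^ Poly_Mapping.lookup m i)" if "finite A" for A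
    using that by (induction A rule: finite_induct) (use one power mult in auto)
  then show ?case
    unfolding single_eq_Const_times_Vars by (intro mult Const) simp
qed (rule add)

text \<open>
  Evaluation at a point and restriction to a line are both instances of the universal map out of
  the polynomial ring: \<open>h\<close> acts on the coefficients and \<open>g i\<close> replaces the variable \<open>i\<close>.
\<close>

definition subst ::
    "('k::comm_ring_1 \<Rightarrow> 'r::comm_ring_1) \<Rightarrow> ('n \<Rightarrow> 'r) \<Rightarrow> ('n::finite, 'k) mpoly \<Rightarrow> 'r"
  where "subst h g f =
    (\<Sum>m\<in>Poly_Mapping.keys f.
       h (Poly_Mapping.lookup f m) * (\<Prod>i\<in>UNIV. g i ^ Poly_Mapping.lookup m i))"

locale coefficient_hom =
  fixes h :: "'k::comm_ring_1 \<Rightarrow> 'r::comm_ring_1"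
  assumes h_1: "h 1 = 1"
    and h_add: "h (a + b) = h a + h b"
    and h_mult: "h (a * b) = h a * h b"
begin

lemma h_0: "h 0 = 0"
  using h_add[of 0 0] by simp

lemma subst_single:
  "subst h g (Poly_Mapping.single m c) = h c * (\<Prod>i\<in>UNIV. g i ^ Poly_Mapping.lookup m i)"
  by (cases "c = 0") (simp_all add: subst_def h_0)

lemma subst_add: "subst h g (f + f') = subst h g f + subst h g f'"
  unfolding subst_def
  by (rule setsum_keys_plus_distrib) (simp_all add: h_0 h_add algebra_simps)

lemma subst_0: "subst h g 0 = 0"
  by (simp add: subst_def)

lemma subst_diff: "subst h g (f - f') = subst h g f - subst h g f'"
  using subst_add[of g "f - f'" f'] by simp

lemma subst_mult: "subst h g (f * f') = subst h g f * subst h g f'"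
proof (induction f rule: mpoly_single_induct)
  case (1 m c)
  show ?case
  proof (induction f' rule: mpoly_single_induct)
    case (1 m' c')
    show ?case
      by (simp add: mult_single subst_single h_mult lookup_add power_add prod.distrib algebra_simps)
  qed (simp add: subst_add algebra_simps)
qed (simp add: subst_add algebra_simps)

lemma subst_Const: "subst h g (Const c) = h c"
  by (simp add: Const_def subst_single)

lemma subst_Var: "subst h g (Var i) = g i"
proof -
  have "(\<Prod>j\<in>UNIV. g j ^ Poly_Mapping.lookup (Poly_Mapping.single i 1) j)
      = (\<Prod>j\<in>UNIV. if j = i then g j else 1)"
    by (rule prod.cong) (auto simp: lookup_single when_def)
  then show ?thesis
    by (simp add: Var_def subst_single h_1)
qed

lemma subst_power: "subst h g (f ^ n) = subst h g f ^ n"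
  by (induction n) (simp_all add: subst_mult subst_Const h_1 flip: Const_1)

end

section \<open>Ideals and their powers\<close>

lemma is_ideal_ideal_gen: "is_ideal (ideal_gen S)"
  by (simp add: is_ideal_def ideal_gen_def module.subspace_span[OF module_times])

lemma ideal_gen_base: "x \<in> S \<Longrightarrow> x \<in> ideal_gen S"
  by (auto simp: ideal_gen_eq_Inter)

lemma ideal_gen_minimal: "is_ideal I \<Longrightarrow> S \<subseteq> I \<Longrightarrow> ideal_gen S \<subseteq> I"
  by (auto simp: ideal_gen_eq_Inter)

lemma is_ideal_ideal_power: "is_ideal (ideal_power I n)"
  by (cases n) (simp_all add: is_ideal_ideal_gen, simp add: is_ideal_iff)

lemma power_mem_ideal_power: "f \<in> I \<Longrightarrow> f ^ n \<in> ideal_power I n"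
  by (induction n) (auto intro!: ideal_gen_base)

lemma power_mem_ideal_power_le:
  assumes "f \<in> I" and "n \<le> N"
  shows "f ^ N \<in> ideal_power I n"
proof -
  have "f ^ N = f ^ (N - n) * f ^ n"
    using assms(2) by (simp flip: power_add)
  then show ?thesis
    using is_ideal_ideal_power[of I n] power_mem_ideal_power[OF assms(1)]
    by (simp add: is_ideal_iff)
qed

text \<open>Comaximality passes to powers: if \<open>h \<in> J\<close> and \<open>1 - h \<in> I\<close>, then \<open>h\<^sup>n \<in> J\<^sup>n\<close> and the factor
  \<open>1 - h\<close> of \<open>1 - h\<^sup>n\<close> keeps the latter in \<open>I\<close>.\<close>

lemma sum_ideal_power_eq_UNIV:
  fixes I J :: "'a::comm_ring_1 set"
  assumes I: "is_ideal I" and h: "h \<in> J" "1 - h \<in> I"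
  shows "I + ideal_power J n = UNIV"
proof -
  have "x \<in> I + ideal_power J n" for x
  proof -
    have "x * (\<Sum>i<n. h ^ i) * (1 - h) \<in> I"
      using I h(2) by (simp add: is_ideal_iff)
    moreover have "x * h ^ n \<in> ideal_power J n"
      using is_ideal_ideal_power[of J n] power_mem_ideal_power[OF h(1)]
      by (simp add: is_ideal_iff)
    moreover have "x = x * (\<Sum>i<n. h ^ i) * (1 - h) + x * h ^ n"
    proof -
      have "(\<Sum>i<n. h ^ i) * (1 - h) + h ^ n = 1"
        using power_diff_1_eq[of h n] by (simp add: algebra_simps)
      then show ?thesis
        by (metis distrib_left mult.assoc mult.right_neutral)
    qed
    ultimately show ?thesis
      by (metis set_plus_intro)
  qed
  then show ?thesis by blast
qed

context coefficient_hom
begin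

lemma is_ideal_subst_dvd: "is_ideal {f. d dvd subst h g f}"
  by (auto simp: is_ideal_iff subst_0 subst_add subst_mult)

text \<open>Vanishing orders add up: the preimage of the ideal \<open>(d\<^sup>n)\<close> is an ideal that contains all
  products of \<open>n\<close> elements of \<open>I\<close>. For a restriction to a line, \<open>d\<close> is the parameter \<open>t\<close>; for an
  evaluation, \<open>d = 0\<close>, and divisibility by \<open>0\<close> means vanishing.\<close>

lemma power_dvd_subst_ideal_power:
  assumes I: "\<And>f. f \<in> I \<Longrightarrow> d dvd subst h g f"
  shows "f \<in> ideal_power I n \<Longrightarrow> d ^ n dvd subst h g f"
proof (induction n arbitrary: f)
  case (Suc n)
  have "ideal_gen {f * g |f g. f \<in> I \<and> g \<in> ideal_power I n} \<subseteq> {f. d ^ Suc n dvd subst h g f}"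
    by (intro ideal_gen_minimal is_ideal_subst_dvd)
      (auto simp: subst_mult intro!: mult_dvd_mono I Suc.IH)
  then show ?case using Suc.prems by auto
qed simp

lemma dvd_subst_max_ideal_at:
  fixes a :: "'k ^ 'n::finite"
  assumes "\<And>i. d dvd g i - h (a $ i)" and f: "f \<in> ideal_gen (range (\<lambda>i. Var i - Const (a $ i)))"
  shows "d dvd subst h g f"
proof -
  have "ideal_gen (range (\<lambda>i. Var i - Const (a $ i))) \<subseteq> {f. d dvd subst h g f}"
    by (intro ideal_gen_minimal is_ideal_subst_dvd)
      (auto simp: subst_diff subst_Var subst_Const assms)
  then show ?thesis using f by auto
qed

end

section \<open>Evaluation at a point\<close>

interpretation evaluation: coefficient_hom "\<lambda>c :: 'k::comm_ring_1. c"
  by standard simp_all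

lemma eval_eq_subst: "eval f a = subst (\<lambda>c. c) (($) a) f"
  by (simp add: eval_def subst_def)

lemmas eval_hom =
  evaluation.subst_0[of "($) a" for a, folded eval_eq_subst]
  evaluation.subst_add[of "($) a" for a, folded eval_eq_subst]
  evaluation.subst_diff[of "($) a" for a, folded eval_eq_subst]
  evaluation.subst_mult[of "($) a" for a, folded eval_eq_subst]
  evaluation.subst_power[of "($) a" for a, folded eval_eq_subst]
  evaluation.subst_Const[of "($) a" for a, folded eval_eq_subst]
  evaluation.subst_Var[of "($) a" for a, folded eval_eq_subst]

lemma eval_ideal_power_max_ideal_at:
  assumes "f \<in> ideal_power (max_ideal_at a) n" and "n > 0"
  shows "eval f a = 0"
proof -
  have "0 dvd subst (\<lambda>c. c) (($) a) g" if "g \<in> max_ideal_at a" for g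
    by (rule evaluation.dvd_subst_max_ideal_at[of _ _ a])
      (use that in \<open>simp_all add: max_ideal_at_def\<close>)
  from evaluation.power_dvd_subst_ideal_power[OF this assms(1)] show ?thesis
    using assms(2) by (simp add: eval_eq_subst power_0_left)
qed

text \<open>Modulo \<open>\<mm>\<^sub>a\<close> each variable is the constant \<open>a\<^sub>i\<close>, and this persists under sums and
  products.\<close>

lemma diff_Const_eval_mem_max_ideal_at:
  fixes f :: "('n::finite, 'k::field) mpoly"
  shows "f - Const (eval f a) \<in> max_ideal_at a"
proof -
  have M: "is_ideal (max_ideal_at a)"
    by (simp add: max_ideal_at_def is_ideal_ideal_gen)
  show ?thesis
  proof (induction f rule: mpoly_generators_induct)
    case (1 c)
    show ?case using M by (simp add: eval_hom is_ideal_iff)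
  next
    case (2 i)
    show ?case by (auto simp: eval_hom max_ideal_at_def intro!: ideal_gen_base)
  next
    case (3 f g)
    have "f + g - Const (eval (f + g) a) = (f - Const (eval f a)) + (g - Const (eval g a))"
      by (simp add: eval_hom Const_add)
    then show ?case using M 3 by (metis is_ideal_iff)
  next
    case (4 f g)
    have "f * g - Const (eval (f * g) a)
        = f * (g - Const (eval g a)) + Const (eval g a) * (f - Const (eval f a))"
      by (simp add: eval_hom Const_mult algebra_simps)
    then show ?case using M 4 by (simp add: is_ideal_iff)
  qed
qed

lemma eval_eq_0_imp_mem_max_ideal_at: "eval f a = 0 \<Longrightarrow> f \<in> max_ideal_at a"
  using diff_Const_eval_mem_max_ideal_at[of f a] by (simp add: Const_0)

section \<open>The identity for bounded weights\<close>

text \<open>Rescaling an element of \<open>I\<close> that is nonzero at \<open>a\<close> to take the value \<open>1\<close> there shows that \<open>I\<close>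
  and \<open>\<mm>\<^sub>a\<close> are comaximal.\<close>

lemma sum_power_max_ideal_at_eq_UNIV:
  fixes I :: "('n::finite, 'k::field) mpoly set"
  assumes I: "is_ideal I" and a: "a \<notin> V_aff I"
  shows "I + ideal_power (max_ideal_at a) n = UNIV"
proof -
  from a obtain g where g: "g \<in> I" "eval g a \<noteq> 0"
    by (auto simp: V_aff_def)
  define h where "h = 1 - Const (inverse (eval g a)) * g"
  have "eval h a = 0"
    using g(2) by (simp add: h_def eval_hom flip: Const_1)
  then have "h \<in> max_ideal_at a"
    by (rule eval_eq_0_imp_mem_max_ideal_at)
  moreover have "1 - h \<in> I"
    using I g(1) by (simp add: h_def is_ideal_iff)
  ultimately show ?thesis
    by (rule sum_ideal_power_eq_UNIV[OF I])
qed

lemma radical_Phi_star_subset: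
  assumes "\<And>a. a \<in> Z \<Longrightarrow> \<mu> a > 0"
  shows "radical (Phi_star Z \<mu> I) \<subseteq> vanishing_ideal (Z \<inter> V_aff I)"
proof
  fix f assume "f \<in> radical (Phi_star Z \<mu> I)"
  then obtain n where n: "n > 0" "f ^ n \<in> Phi_star Z \<mu> I"
    by (auto simp: radical_def)
  have "eval f a = 0" if a: "a \<in> Z" "a \<in> V_aff I" for a
  proof -
    from n(2) a(1) obtain g p where gp: "f ^ n = g + p" "g \<in> I"
      "p \<in> ideal_power (max_ideal_at a) (\<mu> a)"
      by (auto simp: Phi_star_def elim!: set_plus_elim)
    have "eval (f ^ n) a = 0"
      using a(2) gp assms[OF a(1)] eval_ideal_power_max_ideal_at[OF gp(3)]
      by (simp add: eval_hom V_aff_def)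
    then show ?thesis
      by (simp add: eval_hom)
  qed
  then show "f \<in> vanishing_ideal (Z \<inter> V_aff I)"
    by (simp add: vanishing_ideal_def)
qed

theorem radical_Phi_star_eq_vanishing_ideal:
  fixes I :: "('n::finite, 'k::field) mpoly set"
  assumes pos: "\<And>a. a \<in> Z \<Longrightarrow> \<mu> a > 0" and bounded: "bounded_on Z \<mu>" and I: "is_ideal I"
  shows "radical (Phi_star Z \<mu> I) = vanishing_ideal (Z \<inter> V_aff I)"
proof
  show "radical (Phi_star Z \<mu> I) \<subseteq> vanishing_ideal (Z \<inter> V_aff I)"
    by (rule radical_Phi_star_subset[OF pos])
  show "vanishing_ideal (Z \<inter> V_aff I) \<subseteq> radical (Phi_star Z \<mu> I)"
  proof
    fix f assume f: "f \<in> vanishing_ideal (Z \<inter> V_aff I)"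
    from bounded obtain N where N: "N > 0" "\<And>a. a \<in> Z \<Longrightarrow> \<mu> a \<le> N"
      by (auto simp: bounded_on_def)
    have "f ^ N \<in> I + ideal_power (max_ideal_at a) (\<mu> a)" if a: "a \<in> Z" for a
    proof (cases "a \<in> V_aff I")
      case True
      then have "f \<in> max_ideal_at a"
        using f a by (intro eval_eq_0_imp_mem_max_ideal_at) (simp add: vanishing_ideal_def)
      then have "f ^ N \<in> ideal_power (max_ideal_at a) (\<mu> a)"
        using N(2)[OF a] by (rule power_mem_ideal_power_le)
      moreover have "0 \<in> I"
        using I by (simp add: is_ideal_iff)
      ultimately show ?thesis
        using set_plus_intro[of 0 I "f ^ N"] by simp
    next
      case False
      then show ?thesis
        by (simp add: sum_power_max_ideal_at_eq_UNIV[OF I])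
    qed
    then show "f \<in> radical (Phi_star Z \<mu> I)"
      using N(1) by (auto simp: radical_def Phi_star_def)
  qed
qed

section \<open>Restriction to a line and unbounded weights\<close>

interpretation coefficients_to_poly: coefficient_hom "\<lambda>c :: 'k::comm_ring_1. [:c:]"
  by standard (simp_all add: one_pCons)

text \<open>This is the polynomial \<open>f(a + t v)\<close> in the parameter \<open>t\<close>.\<close>

definition on_line :: "'k ^ 'n \<Rightarrow> 'k ^ 'n \<Rightarrow> ('n::finite, 'k::comm_ring_1) mpoly \<Rightarrow> 'k poly"
  where "on_line a v = subst (\<lambda>c. [:c:]) (\<lambda>i. [:a $ i, v $ i:])"

text \<open>Along the line each generator of \<open>\<mm>\<^sub>a\<close> becomes \<open>v\<^sub>i t\<close>, a multiple of \<open>t\<close>.\<close>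

lemma power_dvd_on_line:
  assumes "f \<in> ideal_power (max_ideal_at a) n"
  shows "[:0, 1:] ^ n dvd on_line a v f"
  unfolding on_line_def
proof (rule coefficients_to_poly.power_dvd_subst_ideal_power[OF _ assms])
  fix g assume "g \<in> max_ideal_at a"
  then show "[:0, 1:] dvd subst (\<lambda>c. [:c:]) (\<lambda>i. [:a $ i, v $ i:]) g"
    unfolding max_ideal_at_def
    by (rule coefficients_to_poly.dvd_subst_max_ideal_at[rotated])
      (auto intro: dvdI[where k = "[:v $ i:]" for i])
qed

text \<open>Along the line through \<open>a\<close> in the direction of the \<open>i\<close>-th axis, the variable \<open>i\<close> is \<open>t\<close> itself,
  so its \<open>n\<close>-th power has order exactly \<open>n\<close>.\<close>

lemma Var_power_notin_ideal_power:
  assumes "a $ i = 0" and "n < m"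
  shows "Var i ^ n \<notin> ideal_power (max_ideal_at a) m"
proof
  assume "Var i ^ n \<in> ideal_power (max_ideal_at a) m"
  then have "[:0, 1:] ^ m dvd on_line a (axis i 1) (Var i ^ n)"
    by (rule power_dvd_on_line)
  also have "on_line a (axis i 1) (Var i ^ n) = [:0, 1:] ^ n"
    using assms(1)
    by (simp add: on_line_def coefficients_to_poly.subst_power coefficients_to_poly.subst_Var axis_def)
  finally have "degree ([:0, 1::'a:] ^ m) \<le> degree ([:0, 1::'a:] ^ n)"
    by (rule dvd_imp_degree_le) simp
  then show False
    using assms(2) by (simp add: degree_power_eq)
qed

theorem theorem6p7:
  fixes c :: "nat \<Rightarrow> 'k::alg_closed_field"
    and X :: "('k ^ 2) set"
    and \<nu> :: "'k ^ 2 \<Rightarrow> nat"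
  assumes "inj_on c {1..}"
    and "X = {vector [c j, 0] |j. j \<ge> 1}"
    and "\<And>j. j \<ge> 1 \<Longrightarrow> \<nu> (vector [c j, 0]) = j"
  shows "Var 2 \<in> vanishing_ideal X \<and>
    Var 2 \<notin> radical (Phi_star X \<nu> {0}) \<and>
    (\<forall>(Z :: ('f::field ^ 'n::finite) set) \<mu> I.
       (\<forall>a\<in>Z. \<mu> a > 0) \<and> bounded_on Z \<mu> \<and> is_ideal I \<longrightarrow>
         radical (Phi_star Z \<mu> I) = vanishing_ideal (Z \<inter> V_aff I)) \<and>
    radical (Phi_star X \<nu> {0}) \<noteq> vanishing_ideal (X \<inter> V_aff {0}) \<and>
    \<not> (\<forall>(Z :: ('k ^ 2) set) \<mu> I.
       (\<forall>a\<in>Z. \<mu> a > 0) \<and> is_ideal I \<longrightarrow>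
         radical (Phi_star Z \<mu> I) = vanishing_ideal (Z \<inter> V_aff I))"
proof -
  have vanishes: "Var 2 \<in> vanishing_ideal X"
    by (auto simp: assms(2) vanishing_ideal_def eval_hom)
  have not_radical: "Var 2 \<notin> radical (Phi_star X \<nu> {0})"
  proof
    assume "Var 2 \<in> radical (Phi_star X \<nu> {0})"
    then obtain n where n: "Var 2 ^ n \<in> Phi_star X \<nu> {0}"
      by (auto simp: radical_def)
    define a :: "'k ^ 2" where "a = vector [c (Suc n), 0]"
    have "a \<in> X" "\<nu> a = Suc n"
      using assms(2) assms(3)[of "Suc n"] by (auto simp: a_def)
    with n have "Var 2 ^ n \<in> ideal_power (max_ideal_at a) (Suc n)"
      by (auto simp: Phi_star_def elim!: set_plus_elim)
    then show False
      using Var_power_notin_ideal_power[of a 2 n "Suc n"] by (simp add: a_def)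
  qed
  have "X \<inter> V_aff {0} = X"
    by (auto simp: V_aff_def eval_hom)
  then have differ: "radical (Phi_star X \<nu> {0}) \<noteq> vanishing_ideal (X \<inter> V_aff {0})"
    using vanishes not_radical by metis
  have "\<forall>a\<in>X. \<nu> a > 0"
    using assms(2,3) by auto
  moreover have "is_ideal ({0} :: (2, 'k) mpoly set)"
    by (simp add: is_ideal_iff)
  ultimately show ?thesis
    using vanishes not_radical differ radical_Phi_star_eq_vanishing_ideal by blast
qed

end
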